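(* Let $G,H$ be finite simple graphs on disjoint vertex sets and let $q\ge1$ be an integer. Let $F_G\subseteq V(G)$, $F_H\subseteq V(H)$ and $F=F_G\cup F_H$. Then $F\in\Delta_q(G\ast H)$ if and only if \[ \min\Big(\Big\lfloor\frac{|F_G|+|F_H|}{2}\Big\rfloor,\ |F_G|+\nu(H[F_H]),\ |F_H|+\nu(G[F_G])\Big)<q. \]
   Context: For a finite simple graph $X$, $\nu(X)$ is the matching number (the largest number of pairwise vertex-disjoint edges; $0$ for the empty graph), and $X[F]$ is the subgraph induced on $F\subseteq V(X)$. For $q\ge1$, $\Delta_q(X):=\{F\subseteq V(X):\nu(X[F])<q\}$, a simplicial complex on $V(X)$. The join $G\ast H$ has vertex set $V(G)\cup V(H)$ and edge set $E(G)\cup E(H)\cup\{gh: g\in V(G),\ h\in V(H)\}$. *)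

theory Defs
  imports Main
begin

text \<open>An undirected graph is given by its vertex set and its edge set; an edge is the
  two-element set of its end vertices, so there are no loops and no multiple edges.\<close>

record 'a graph =
  verts :: "'a set"
  edges :: "'a set set"

definition finite_simple_graph :: "'a graph \<Rightarrow> bool" where
  "finite_simple_graph X \<longleftrightarrow>
     finite (verts X) \<and> (\<forall>e\<in>edges X. e \<subseteq> verts X \<and> card e = 2)"

definition induced_subgraph :: "'a graph \<Rightarrow> 'a set \<Rightarrow> 'a graph" where
  "induced_subgraph X F = \<lparr>verts = F, edges = {e \<in> edges X. e \<subseteq> F}\<rparr>"

definition matching :: "'a graph \<Rightarrow> 'a set set \<Rightarrow> bool" where
  "matching X M \<longleftrightarrow> M \<subseteq> edges X \<and> pairwise disjnt M"

text \<open>In a finite graph the set of matchings is finite, and it contains the empty matching, so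
  the maximum below is attained; for a graph without edges it is \<open>0\<close>.\<close>

definition matching_number :: "'a graph \<Rightarrow> nat" where
  "matching_number X = Max (card ` {M. matching X M})"

definition matching_complex :: "nat \<Rightarrow> 'a graph \<Rightarrow> 'a set set" where
  "matching_complex q X =
     {F. F \<subseteq> verts X \<and> matching_number (induced_subgraph X F) < q}"

text \<open>The join is only meant for graphs with disjoint vertex sets.\<close>

definition graph_join :: "'a graph \<Rightarrow> 'a graph \<Rightarrow> 'a graph" where
  "graph_join G H =
     \<lparr>verts = verts G \<union> verts H,
      edges = edges G \<union> edges H \<union> {{g, h} | g h. g \<in> verts G \<and> h \<in> verts H}\<rparr>"

lemma finite_simple_graph_induced_subgraph:
  assumes "finite_simple_graph X" and "F \<subseteq> verts X"
  shows "finite_simple_graph (induced_subgraph X F)"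
  using assms by (auto simp: finite_simple_graph_def induced_subgraph_def intro: finite_subset)

lemma finite_simple_graph_join:
  assumes "finite_simple_graph G" and "finite_simple_graph H" and "verts G \<inter> verts H = {}"
  shows "finite_simple_graph (graph_join G H)"
  using assms by (fastforce simp: finite_simple_graph_def graph_join_def card_2_iff)

lemma finite_matchings:
  assumes "finite_simple_graph X"
  shows "finite {M. matching X M}"
proof -
  have "finite (edges X)"
    using assms by (auto simp: finite_simple_graph_def intro: finite_subset[of _ "Pow (verts X)"])
  then show ?thesis
    by (auto simp: matching_def intro: finite_subset[of _ "Pow (edges X)"])
qed

lemma matching_number_no_edges: "edges X = {} \<Longrightarrow> matching_number X = 0"
  by (simp add: matching_number_def matching_def cong: conj_cong)

end

theory Submission
  imports Defs
begin

text \<open>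
  An induced subgraph of a join is the join of the induced subgraphs, so the theorem is the
  formula for the matching number of a join \<open>A * B\<close> with \<open>a\<close> and \<open>b\<close> vertices:
  \<open>\<nu>(A * B) = min ((a + b) div 2) (a + \<nu>(B)) (b + \<nu>(A))\<close>.

  Each term is an upper bound. A matching covers two vertices per edge, which gives
  \<open>(a + b) div 2\<close>. An edge of the join that avoids \<open>A\<close> is an edge of \<open>B\<close>; a matching has at most
  \<open>\<nu>(B)\<close> of those, and at most \<open>a\<close> edges meet \<open>A\<close> since disjoint edges meet it in different
  vertices. Exchanging \<open>A\<close> and \<open>B\<close> gives the third bound (\<open>matching_number_join_le\<close>).

  For the converse let \<open>a \<le> b\<close>; then \<open>(a + b) div 2 \<le> b\<close>, so the third term never decides the
  minimum. A matching of \<open>B\<close> with \<open>k = min (\<nu>(B)) ((b - a) div 2)\<close> edges leaves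
  \<open>b - 2 * k \<ge> a\<close> vertices of \<open>B\<close> uncovered, and each vertex of \<open>A\<close> can be joined to one of its
  own among them. The resulting matching has \<open>a + k\<close> edges, which is the minimum of
  \<open>a + \<nu>(B)\<close> and \<open>(a + b) div 2\<close> (\<open>matching_number_join_ge\<close>).
\<close>

lemma card_le_matching_number:
  assumes "finite_simple_graph X" and "matching X M"
  shows "card M \<le> matching_number X"
  unfolding matching_number_def using assms finite_matchings by (intro Max_ge) auto

lemma matching_of_card:
  assumes "finite_simple_graph X" and "k \<le> matching_number X"
  obtains M where "matching X M" and "card M = k"
proof -
  have "matching X {}"
    by (simp add: matching_def)
  then have "matching_number X \<in> card ` {M. matching X M}"
    unfolding matching_number_def using finite_matchings[OF assms(1)] by (intro Max_in) auto
  then obtain M where M: "matching X M" "card M = matching_number X"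
    by auto
  obtain N where "N \<subseteq> M" "card N = k"
    using assms(2) M(2) by (metis obtain_subset_with_card_n)
  moreover from this M(1) have "matching X N"
    by (auto simp: matching_def intro: pairwise_subset)
  ultimately show thesis
    using that by blast
qed

lemma card_Union_matching:
  assumes "finite_simple_graph X" and "matching X M"
  shows "card (\<Union>M) = 2 * card M"
proof -
  have two: "card e = 2" if "e \<in> M" for e
    using assms that by (auto simp: finite_simple_graph_def matching_def)
  have "card (\<Union>M) = sum card M"
    using assms(2) two
    by (intro card_Union_disjoint) (auto simp: matching_def intro: card_ge_0_finite)
  then show ?thesis
    using two by simp
qed

lemma finite_matching:
  assumes "finite_simple_graph X" and "matching X M"
  shows "finite M"
  using assms
  by (auto simp: finite_simple_graph_def matching_def intro: finite_subset[of _ "Pow (verts X)"])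

text \<open>A point of \<open>V\<close> chosen in each of the sets determines that set, because the sets are
  disjoint.\<close>

lemma card_disjoint_sets_meeting_le:
  assumes "pairwise disjnt M" and "finite V"
  shows "card {e \<in> M. e \<inter> V \<noteq> {}} \<le> card V"
proof -
  have "\<forall>e \<in> {e \<in> M. e \<inter> V \<noteq> {}}. \<exists>v. v \<in> e \<inter> V"
    by blast
  then obtain f where f: "\<forall>e \<in> {e \<in> M. e \<inter> V \<noteq> {}}. f e \<in> e \<inter> V"
    by metis
  moreover have "e = d" if "e \<in> M" "d \<in> M" "x \<in> e" "x \<in> d" for e d x
    using assms(1) that by (metis disjnt_iff pairwiseD)
  ultimately have "inj_on f {e \<in> M. e \<inter> V \<noteq> {}}"
    by (intro inj_onI) (metis (no_types, lifting) IntD1 mem_Collect_eq)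
  then show ?thesis
    using f assms(2) by (intro card_inj_on_le[of f]) auto
qed

lemma graph_join_commute: "graph_join G H = graph_join H G"
  by (auto simp: graph_join_def insert_commute)

text \<open>Edges of \<open>G\<close> inside \<open>F_G \<union> F_H\<close> cannot use vertices of \<open>F_H\<close>, as the vertex sets are
  disjoint; the same holds for \<open>H\<close> and for the ends of the added edges.\<close>

lemma induced_subgraph_join:
  assumes "finite_simple_graph G" and "finite_simple_graph H" and "verts G \<inter> verts H = {}"
    and "F_G \<subseteq> verts G" and "F_H \<subseteq> verts H"
  shows "induced_subgraph (graph_join G H) (F_G \<union> F_H) =
    graph_join (induced_subgraph G F_G) (induced_subgraph H F_H)"
proof -
  have "e \<subseteq> verts G" if "e \<in> edges G" for e
    using assms(1) that by (simp add: finite_simple_graph_def)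
  then have G: "{e \<in> edges G. e \<subseteq> F_G \<union> F_H} = {e \<in> edges G. e \<subseteq> F_G}"
    using assms(3,5) by blast
  have "e \<subseteq> verts H" if "e \<in> edges H" for e
    using assms(2) that by (simp add: finite_simple_graph_def)
  then have H: "{e \<in> edges H. e \<subseteq> F_G \<union> F_H} = {e \<in> edges H. e \<subseteq> F_H}"
    using assms(3,4) by blast
  have "{g, h} \<subseteq> F_G \<union> F_H \<longleftrightarrow> g \<in> F_G \<and> h \<in> F_H" if "g \<in> verts G" "h \<in> verts H" for g h
    using assms(3-5) that by auto
  then have cross: "{{g, h} | g h. g \<in> verts G \<and> h \<in> verts H} \<inter> {e. e \<subseteq> F_G \<union> F_H} =
      {{g, h} | g h. g \<in> F_G \<and> h \<in> F_H}"
    using assms(4,5) by blast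
  have "{e \<in> S \<union> T \<union> U. P e} = {e \<in> S. P e} \<union> {e \<in> T. P e} \<union> U \<inter> {e. P e}"
    for S T U :: "'a set set" and P
    by blast
  then show ?thesis
    by (simp only: induced_subgraph_def graph_join_def graph.simps G H cross)
qed

text \<open>The edges of the join that do not meet \<open>A\<close> are edges of \<open>B\<close>, so a matching splits into a
  matching of \<open>B\<close> and a part that \<open>A\<close> has enough vertices for.\<close>

lemma matching_number_join_le:
  assumes "finite_simple_graph A" and "finite_simple_graph B" and "verts A \<inter> verts B = {}"
  shows "matching_number (graph_join A B) \<le> card (verts A) + matching_number B"
proof -
  note J = finite_simple_graph_join[OF assms]
  obtain M where M: "matching (graph_join A B) M" "card M = matching_number (graph_join A B)"
    using matching_of_card[OF J order_refl] by blast
  have "matching B {e \<in> M. e \<inter> verts A = {}}"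
    unfolding matching_def
  proof
    have "e \<inter> verts A \<noteq> {}" if "e \<in> edges A" for e
      using assms(1) that by (force simp: finite_simple_graph_def Int_absorb2)
    then show "{e \<in> M. e \<inter> verts A = {}} \<subseteq> edges B"
      using M(1) unfolding matching_def graph_join_def graph.simps by blast
    show "pairwise disjnt {e \<in> M. e \<inter> verts A = {}}"
      using M(1) by (auto simp: matching_def intro: pairwise_subset)
  qed
  then have "card {e \<in> M. e \<inter> verts A = {}} \<le> matching_number B"
    using assms(2) by (rule card_le_matching_number[rotated])
  moreover have "card {e \<in> M. e \<inter> verts A \<noteq> {}} \<le> card (verts A)"
    using assms(1) M(1)
    by (intro card_disjoint_sets_meeting_le) (auto simp: matching_def finite_simple_graph_def)
  moreover have "card M = card {e \<in> M. e \<inter> verts A \<noteq> {}} + card {e \<in> M. e \<inter> verts A = {}}"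
    using finite_matching[OF J M(1)]
    by (subst card_Un_disjoint[symmetric]) (auto intro: arg_cong[of _ _ card])
  ultimately show ?thesis
    using M(2) by linarith
qed

lemma matching_number_le_half:
  assumes "finite_simple_graph X"
  shows "matching_number X \<le> card (verts X) div 2"
proof -
  obtain M where M: "matching X M" "card M = matching_number X"
    using matching_of_card[OF assms order_refl] by blast
  have "\<Union>M \<subseteq> verts X"
    using assms M(1) by (auto simp: finite_simple_graph_def matching_def)
  then have "2 * card M \<le> card (verts X)"
    using card_Union_matching[OF assms M(1)] assms
    by (metis card_mono finite_simple_graph_def)
  then show ?thesis
    using M(2) by linarith
qed

text \<open>The hypothesis on the sizes makes room in \<open>B\<close> for a partner of every vertex of \<open>A\<close>;
  the edges of \<open>B\<close> then only have to use up the vertices left over.\<close>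

lemma matching_number_join_ge:
  assumes "finite_simple_graph A" and "finite_simple_graph B" and "verts A \<inter> verts B = {}"
    and le: "card (verts A) \<le> card (verts B)"
  shows "min ((card (verts A) + card (verts B)) div 2) (card (verts A) + matching_number B)
    \<le> matching_number (graph_join A B)"
proof -
  have fin: "finite (verts A)" "finite (verts B)"
    using assms(1,2) by (auto simp: finite_simple_graph_def)
  \<comment> \<open>More edges inside \<open>B\<close> than \<open>(b - a) div 2\<close> would leave fewer than \<open>a\<close> free vertices.\<close>
  define k where "k = min (matching_number B) ((card (verts B) - card (verts A)) div 2)"
  obtain N where N: "matching B N" "card N = k"
    using matching_of_card[OF assms(2), of k] by (auto simp: k_def)
  have sub: "\<Union>N \<subseteq> verts B"
    using assms(2) N(1) by (auto simp: finite_simple_graph_def matching_def)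
  then have "card (verts B - \<Union>N) = card (verts B) - 2 * k"
    using card_Union_matching[OF assms(2) N(1)] N(2) fin(2)
    by (metis card_Diff_subset finite_subset)
  then have "card (verts A) \<le> card (verts B - \<Union>N)"
    using le by (simp add: k_def)
  then obtain f where f: "f ` verts A \<subseteq> verts B - \<Union>N" "inj_on f (verts A)"
    using fin card_le_inj[of "verts A" "verts B - \<Union>N"] by auto
  define C where "C = (\<lambda>v. {v, f v}) ` verts A"
  have "inj_on (\<lambda>v. {v, f v}) (verts A)"
  proof (rule inj_onI)
    fix v w
    assume "v \<in> verts A" "w \<in> verts A" "{v, f v} = {w, f w}"
    moreover from this have "f w \<notin> verts A"
      using f(1) assms(3) by blast
    ultimately show "v = w"
      by (auto simp: doubleton_eq_iff)
  qed
  then have card_C: "card C = card (verts A)"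
    by (simp add: C_def card_image)
  have NC: "disjnt e c" if "e \<in> N" "c \<in> C" for e c
    using that f(1) sub assms(3) by (fastforce simp: C_def disjnt_iff)
  have CC: "disjnt c d" if "c \<in> C" "d \<in> C" "c \<noteq> d" for c d
  proof -
    obtain v w where vw: "v \<in> verts A" "w \<in> verts A" "c = {v, f v}" "d = {w, f w}"
      using \<open>c \<in> C\<close> \<open>d \<in> C\<close> by (auto simp: C_def)
    then have "v \<noteq> w" "f v \<noteq> f w" "f v \<notin> verts A" "f w \<notin> verts A"
      using \<open>c \<noteq> d\<close> f assms(3) by (auto dest: inj_onD)
    with vw show ?thesis
      by (auto simp: disjnt_iff)
  qed
  have "matching (graph_join A B) (N \<union> C)"
    unfolding matching_def
  proof
    show "N \<union> C \<subseteq> edges (graph_join A B)"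
      using N(1) f(1) by (auto simp: matching_def graph_join_def C_def)
    show "pairwise disjnt (N \<union> C)"
    proof (rule pairwiseI)
      fix c d
      assume "c \<in> N \<union> C" "d \<in> N \<union> C" "c \<noteq> d"
      then show "disjnt c d"
        using N(1) NC[of c d] NC[of d c, THEN disjnt_sym] CC[of c d]
        by (auto simp: matching_def dest: pairwiseD)
    qed
  qed
  then have "card (N \<union> C) \<le> matching_number (graph_join A B)"
    using finite_simple_graph_join[OF assms(1-3)] by (rule card_le_matching_number[rotated])
  moreover have "c \<noteq> {}" if "c \<in> C" for c
    using that by (auto simp: C_def)
  then have "N \<inter> C = {}"
    using NC by (metis disjnt_self_iff_empty disjoint_iff)
  then have "card (N \<union> C) = k + card (verts A)"
    using finite_matching[OF assms(2) N(1)] fin(1) N(2) card_C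
    by (simp add: card_Un_disjoint C_def)
  moreover have "(card (verts A) + card (verts B)) div 2 =
      card (verts A) + (card (verts B) - card (verts A)) div 2"
    using le by linarith
  ultimately show ?thesis
    unfolding k_def by linarith
qed

theorem matching_number_join:
  assumes "finite_simple_graph A" and "finite_simple_graph B" and "verts A \<inter> verts B = {}"
  shows "matching_number (graph_join A B) =
    Min {(card (verts A) + card (verts B)) div 2,
         card (verts A) + matching_number B,
         card (verts B) + matching_number A}"
proof -
  have swap: "verts B \<inter> verts A = {}"
    using assms(3) by blast
  have "card (verts (graph_join A B)) = card (verts A) + card (verts B)"
    using assms by (simp add: graph_join_def finite_simple_graph_def card_Un_disjoint)
  then have "matching_number (graph_join A B) \<le> (card (verts A) + card (verts B)) div 2"
    using matching_number_le_half[OF finite_simple_graph_join[OF assms]] by simp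
  moreover have "matching_number (graph_join A B) \<le> card (verts A) + matching_number B"
    using matching_number_join_le[OF assms] .
  moreover have "matching_number (graph_join A B) \<le> card (verts B) + matching_number A"
    using matching_number_join_le[OF assms(2,1) swap] by (simp add: graph_join_commute)
  moreover have "min ((card (verts A) + card (verts B)) div 2)
      (min (card (verts A) + matching_number B) (card (verts B) + matching_number A))
      \<le> matching_number (graph_join A B)"
  proof (cases "card (verts A) \<le> card (verts B)")
    case True
    then show ?thesis
      using matching_number_join_ge[OF assms] by linarith
  next
    case False
    then have "min ((card (verts B) + card (verts A)) div 2) (card (verts B) + matching_number A)
        \<le> matching_number (graph_join A B)"
      using matching_number_join_ge[OF assms(2,1) swap] graph_join_commute[of A B] by simp
    then show ?thesis
      by linarith
  qed
  ultimately show ?thesis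
    by simp
qed

theorem theorem4p2:
  fixes G H :: "'a graph" and F_G F_H F :: "'a set" and q :: nat
  assumes "finite_simple_graph G"
    and "finite_simple_graph H"
    and "verts G \<inter> verts H = {}"
    and "q \<ge> 1"
    and "F_G \<subseteq> verts G"
    and "F_H \<subseteq> verts H"
    and "F = F_G \<union> F_H"
  shows "F \<in> matching_complex q (graph_join G H) \<longleftrightarrow>
    Min {(card F_G + card F_H) div 2,
         card F_G + matching_number (induced_subgraph H F_H),
         card F_H + matching_number (induced_subgraph G F_G)} < q"
proof -
  have verts_induced: "verts (induced_subgraph X S) = S" for X :: "'a graph" and S
    by (simp add: induced_subgraph_def)
  have "F \<subseteq> verts (graph_join G H)"
    using assms(5-7) by (auto simp: graph_join_def)
  moreover have "matching_number (induced_subgraph (graph_join G H) F) =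
      Min {(card F_G + card F_H) div 2,
           card F_G + matching_number (induced_subgraph H F_H),
           card F_H + matching_number (induced_subgraph G F_G)}"
    unfolding assms(7) induced_subgraph_join[OF assms(1,2,3,5,6)]
    using matching_number_join[of "induced_subgraph G F_G" "induced_subgraph H F_H"] assms(3,5,6)
      finite_simple_graph_induced_subgraph[OF assms(1,5)]
      finite_simple_graph_induced_subgraph[OF assms(2,6)]
    unfolding verts_induced by blast
  ultimately show ?thesis
    by (simp add: matching_complex_def)
qed

end
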